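(* Let $a \in \mathbf{F}_q$ be nonzero and let $f(x) \in \mathbf{F}_q[x]$ be an $a$-self reciprocal monic polynomial of even degree. Then $f(x)$ can be written as $f(x) = (x^2-a)^k\cdot g(x)$, where $k \geq 0$ is an integer, $g(x) \in \mathbf{F}_q[x]$ is a nontrivial $a$-self reciprocal monic polynomial not divisible by $x^2-a$, and $k$ is odd if $f(x)$ is trivial, while $k$ is even if $f(x)$ is nontrivial.
   Context: Let $q=p^e$ be an odd prime power and $\mathbf{F}_q$ the finite field with $q$ elements. For a nonzero $a\in\mathbf{F}_q$ and a monic polynomial $f(x)=\sum_{i=0}^n b_i x^i \in \mathbf{F}_q[x]$ of degree $n$ with $f(0)\neq 0$, the $a$-reciprocal of $f$ is $\hat{f}_a(x) := \frac{x^n}{f(0)} f\left(\frac{a}{x}\right) = \frac{1}{b_0}\sum_{i=0}^n b_i a^i x^{n-i}$. A monic polynomial $f(x)$ (with $f(0)\ne 0$) is $a$-self reciprocal if $\hat{f}_a(x)=f(x)$; comparing coefficients gives $b_0^2=a^n$. An $a$-self reciprocal monic polynomial of even degree $n=2m$ ($m \ge 0$) is called trivial if $b_0=-a^m$ and nontrivial if $b_0=a^m$. In particular the constant polynomial $1$ (degree $0$) counts as a nontrivial $a$-self reciprocal monic polynomial. *)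

theory Defs
  imports
    "HOL-Library.Cardinality"
    "HOL-Computational_Algebra.Primes"
    "HOL-Computational_Algebra.Polynomial"
begin

definition a_reciprocal :: "'a::field \<Rightarrow> 'a poly \<Rightarrow> 'a poly" where
  "a_reciprocal a f =
     smult (1 / poly f 0) (\<Sum>i\<le>degree f. monom (coeff f i * a ^ i) (degree f - i))"

definition a_self_reciprocal_monic :: "'a::field \<Rightarrow> 'a poly \<Rightarrow> bool" where
  "a_self_reciprocal_monic a f \<longleftrightarrow>
     lead_coeff f = 1 \<and> poly f 0 \<noteq> 0 \<and> a_reciprocal a f = f"

definition trivial_self_reciprocal :: "'a::field \<Rightarrow> 'a poly \<Rightarrow> bool" where
  "trivial_self_reciprocal a f \<longleftrightarrow>
     a_self_reciprocal_monic a f \<and> (\<exists>m. degree f = 2 * m \<and> coeff f 0 = - (a ^ m))"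

definition nontrivial_self_reciprocal :: "'a::field \<Rightarrow> 'a poly \<Rightarrow> bool" where
  "nontrivial_self_reciprocal a f \<longleftrightarrow>
     a_self_reciprocal_monic a f \<and> (\<exists>m. degree f = 2 * m \<and> coeff f 0 = a ^ m)"

text \<open>The coefficient formula agrees with $x^n f(a/x) / f(0)$ as a function on nonzero $x$.\<close>

lemma poly_a_reciprocal:
  assumes "x \<noteq> 0"
  shows "poly (a_reciprocal a f) x = x ^ degree f / poly f 0 * poly f (a / x)"
proof -
  have "coeff f i * a ^ i * x ^ (degree f - i) = x ^ degree f * (coeff f i * (a / x) ^ i)"
    if "i \<le> degree f" for i
    using that assms by (simp add: power_diff power_divide field_simps)
  then have "(\<Sum>i\<le>degree f. coeff f i * a ^ i * x ^ (degree f - i)) =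
      x ^ degree f * poly f (a / x)"
    unfolding poly_altdef sum_distrib_left by (intro sum.cong) auto
  then show ?thesis
    by (simp add: a_reciprocal_def poly_sum poly_monom)
qed

lemma nontrivial_self_reciprocal_1: "nontrivial_self_reciprocal a 1"
  by (simp add: nontrivial_self_reciprocal_def a_self_reciprocal_monic_def a_reciprocal_def)

end

theory Submission
  imports Defs
begin

text \<open>
  Modulo $x^2 - a$ one has $a^i x^{n-i} \equiv x^{n+i}$, so $f(0) \hat f_a \equiv x^n f \equiv a^m f$
  for $n = 2m$. If $f = \hat f_a$ is trivial this reads $-a^m f \equiv a^m f$, so $x^2 - a$ divides
  $f$ because $2 a^m \neq 0$. The $a$-reciprocal is multiplicative, hence dividing $f$ by the trivial
  polynomial $x^2 - a$ keeps it self reciprocal and swaps trivial and nontrivial; repeat until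
  $x^2 - a$ no longer divides the quotient.
\<close>

text \<open>Translation by 1 permutes the ring, so comparing the sum of all elements before and
  after it gives \<open>of_nat CARD('a) = 0\<close>. If 2 were 0, an odd cardinality would turn this
  into 1 = 0.\<close>

lemma two_neq_0_odd_card:
  assumes "odd CARD('a :: {comm_ring_1, finite})"
  shows "(2 :: 'a) \<noteq> 0"
proof
  assume two: "(2 :: 'a) = 0"
  have "(\<Sum>x\<in>UNIV. x + 1) = (\<Sum>x\<in>UNIV. x :: 'a)"
    by (rule sum.reindex_bij_witness[of _ "\<lambda>x. x - 1" "\<lambda>x. x + 1"]) auto
  then have "of_nat CARD('a) = (0 :: 'a)"
    by (simp add: sum.distrib)
  moreover obtain k where "CARD('a) = 2 * k + 1"
    using assms by (rule oddE)
  ultimately show False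
    by (simp add: two)
qed

text \<open>Substituting \<open>a * x\<close> for \<open>x\<close> scales coefficient
  \<open>i\<close> by \<open>a ^ i\<close>, and reflection reverses the order;
  \<open>a \<noteq> 0\<close> preserves the degree about which one reflects. Both operations respect
  products, which yields multiplicativity of the a-reciprocal.\<close>

lemma a_reciprocal_altdef:
  assumes "a \<noteq> 0"
  shows "a_reciprocal a f = smult (1 / poly f 0) (reflect_poly (f \<circ>\<^sub>p [:0, a:]))"
proof -
  have deg: "degree (f \<circ>\<^sub>p [:0, a:]) = degree f"
    using assms by (simp add: degree_pcompose)
  have "coeff (\<Sum>i\<le>degree f. monom (coeff f i * a ^ i) (degree f - i)) j =
      coeff (reflect_poly (f \<circ>\<^sub>p [:0, a:])) j" for j
  proof (cases "j \<le> degree f")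
    case True
    have "(\<Sum>i\<le>degree f. coeff (monom (coeff f i * a ^ i) (degree f - i)) j) =
        (\<Sum>i\<in>{degree f - j}. coeff f i * a ^ i)"
      using True by (intro sum.mono_neutral_cong_right) auto
    with True show ?thesis
      by (simp add: coeff_sum coeff_reflect_poly deg coeff_pcompose_linear)
  next
    case False
    then show ?thesis
      by (auto simp: coeff_sum coeff_reflect_poly deg intro!: sum.neutral)
  qed
  then show ?thesis
    by (simp add: a_reciprocal_def poly_eq_iff)
qed

lemma a_reciprocal_mult:
  assumes "a \<noteq> 0"
  shows "a_reciprocal a (f * g) = a_reciprocal a f * a_reciprocal a g"
  by (simp add: a_reciprocal_altdef[OF assms] pcompose_mult reflect_poly_mult mult.commute)

lemma a_self_reciprocal_monic_cancel:
  assumes "a \<noteq> 0" "a_self_reciprocal_monic a g" "a_self_reciprocal_monic a (g * h)"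
  shows "a_self_reciprocal_monic a h"
proof -
  have "g * a_reciprocal a h = g * h" "g \<noteq> 0"
    using assms by (auto simp: a_self_reciprocal_monic_def a_reciprocal_mult)
  then have "a_reciprocal a h = h"
    by simp
  with assms show ?thesis
    by (auto simp: a_self_reciprocal_monic_def lead_coeff_mult)
qed

lemma a_self_reciprocal_monic_quadratic:
  assumes "a \<noteq> 0"
  shows "a_self_reciprocal_monic a [:- a, 0, 1:]"
  using assms
  by (auto simp: a_self_reciprocal_monic_def a_reciprocal_def numeral_2_eq_2 monom_Suc monom_0 power2_eq_square)

text \<open>Since \<open>f\<close> is monic, its reciprocal has constant term
  \<open>a ^ degree f / coeff f 0\<close>; compare it with that of \<open>f\<close>.\<close>

lemma a_self_reciprocal_monic_coeff_0:
  assumes "a_self_reciprocal_monic a f" "a \<noteq> 0"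
  shows "coeff f 0 ^ 2 = a ^ degree f"
proof -
  have f: "a_reciprocal a f = f" "lead_coeff f = 1" "coeff f 0 \<noteq> 0"
    using assms by (auto simp: a_self_reciprocal_monic_def poly_0_coeff_0)
  have "coeff (a_reciprocal a f) 0 = a ^ degree f / coeff f 0"
    using assms(2) f(2)
    by (simp add: a_reciprocal_altdef coeff_pcompose_linear degree_pcompose poly_0_coeff_0)
  with f show ?thesis
    by (simp add: field_simps power2_eq_square)
qed

lemma self_reciprocal_cases:
  assumes "a_self_reciprocal_monic a f" "a \<noteq> 0" "even (degree f)"
  shows "trivial_self_reciprocal a f \<or> nontrivial_self_reciprocal a f"
proof -
  obtain m where m: "degree f = 2 * m"
    using assms(3) by blast
  then have "coeff f 0 ^ 2 = (a ^ m) ^ 2"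
    using a_self_reciprocal_monic_coeff_0[OF assms(1,2)] by (simp add: power_mult mult.commute)
  then show ?thesis
    using assms m
    by (auto simp: power2_eq_iff trivial_self_reciprocal_def nontrivial_self_reciprocal_def)
qed

lemma dvd_power_diff:
  fixes x y :: "'a :: comm_ring_1"
  shows "x - y dvd x ^ n - y ^ n"
  by (metis dvd_triv_left power_diff_sumr2)

lemma quadratic_dvd_if_trivial:
  fixes a :: "'a :: field"
  assumes "(2 :: 'a) \<noteq> 0" "a \<noteq> 0" "trivial_self_reciprocal a f"
  shows "[:- a, 0, 1:] dvd f"
proof -
  define X :: "'a poly" where "X = monom 1 1"
  define Q where "Q = [:- a, 0, 1:]"
  have Q: "Q = X ^ 2 - [:a:]"
    by (simp add: Q_def X_def monom_power power2_eq_square monom_Suc monom_0 numeral_2_eq_2)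
  obtain m where m: "degree f = 2 * m" and c: "coeff f 0 = - (a ^ m)"
    and self: "a_self_reciprocal_monic a f"
    using assms by (auto simp: trivial_self_reciprocal_def)
  \<comment> \<open>This is the congruence of \<open>X ^ 2\<close> and \<open>a\<close> modulo
    \<open>Q\<close>, raised to the power \<open>i\<close>.\<close>
  have pow: "Q dvd X ^ (2 * i) - [:a ^ i:]" for i
    using dvd_power_diff[of "X ^ 2" "[:a:]" i] by (simp add: Q power_mult poly_const_pow)
  have "smult (- (a ^ m)) f = smult (poly f 0) (a_reciprocal a f)" "poly f 0 \<noteq> 0"
    using self c by (auto simp: a_self_reciprocal_monic_def poly_0_coeff_0)
  then have "smult (- (a ^ m)) f = (\<Sum>i\<le>degree f. monom (coeff f i * a ^ i) (degree f - i))"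
    by (simp add: a_reciprocal_def)
  also have "\<dots> = (\<Sum>i\<le>degree f. smult (coeff f i) ([:a ^ i:] * X ^ (degree f - i)))"
    by (simp add: X_def monom_power smult_monom)
  finally have recip: "smult (- (a ^ m)) f = \<dots>" .
  \<comment> \<open>The exponent 2m + i is split as 2i + (2m - i), so that the sum matches
    \<open>recip\<close> term by term with \<open>X ^ (2 * i)\<close> in place of
    \<open>a ^ i\<close>.\<close>
  have Xf: "X ^ (2 * m) * f = (\<Sum>i\<le>degree f. smult (coeff f i) (X ^ (2 * i) * X ^ (degree f - i)))"
  proof -
    have "f = (\<Sum>i\<le>degree f. smult (coeff f i) (X ^ i))"
      by (simp add: X_def monom_power smult_monom poly_as_sum_of_monoms)
    then have "X ^ (2 * m) * f = (\<Sum>i\<le>degree f. smult (coeff f i) (X ^ (2 * m) * X ^ i))"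
      by (metis (no_types, lifting) mult_smult_right sum.cong sum_distrib_left)
    also have "\<dots> = (\<Sum>i\<le>degree f. smult (coeff f i) (X ^ (2 * i) * X ^ (degree f - i)))"
      by (intro sum.cong refl) (simp add: m add.commute flip: power_add)
    finally show ?thesis .
  qed
  have "X ^ (2 * m) * f - smult (- (a ^ m)) f =
      (\<Sum>i\<le>degree f. smult (coeff f i) ((X ^ (2 * i) - [:a ^ i:]) * X ^ (degree f - i)))"
    unfolding Xf recip by (simp add: sum_subtractf left_diff_distrib smult_diff_right)
  also have "Q dvd \<dots>"
    by (intro dvd_sum dvd_smult dvd_mult2 pow)
  finally have "Q dvd X ^ (2 * m) * f - smult (- (a ^ m)) f" .
  moreover have "Q dvd (X ^ (2 * m) - [:a ^ m:]) * f"
    by (intro dvd_mult2 pow)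
  \<comment> \<open>The terms \<open>X ^ (2 * m) * f\<close> cancel, and the two copies of
    \<open>a ^ m\<close> times \<open>f\<close> add up because triviality supplies the minus sign.
    The resulting factor \<open>2 * a ^ m\<close> is a unit.\<close>
  ultimately have "Q dvd (X ^ (2 * m) * f - smult (- (a ^ m)) f) - (X ^ (2 * m) - [:a ^ m:]) * f"
    by (rule dvd_diff)
  also have "\<dots> = smult (2 * a ^ m) f"
    by (simp add: left_diff_distrib flip: smult_add_left)
  finally show ?thesis
    using assms by (simp add: Q_def dvd_smult_iff)
qed

text \<open>The factor contributes constant term \<open>- a\<close>: removing it lowers the
  half-degree by one, which accounts for the \<open>a\<close>, and the remaining sign exchanges the
  two types.\<close>

lemma type_quadratic_mult:
  assumes "a \<noteq> 0" "a_self_reciprocal_monic a h"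
  shows "trivial_self_reciprocal a ([:- a, 0, 1:] * h) \<Longrightarrow> nontrivial_self_reciprocal a h"
    and "nontrivial_self_reciprocal a ([:- a, 0, 1:] * h) \<Longrightarrow> trivial_self_reciprocal a h"
proof -
  have "h \<noteq> 0"
    using assms by (auto simp: a_self_reciprocal_monic_def)
  then have deg: "degree ([:- a, 0, 1:] * h) = degree h + 2"
    by (subst degree_mult_eq) auto
  have coeff: "coeff ([:- a, 0, 1:] * h) 0 = - a * coeff h 0"
    by (simp add: coeff_mult)
  have half: "\<exists>k. m = Suc k \<and> degree h = 2 * k" if "degree h + 2 = 2 * m" for m
    using that by (intro exI[of _ "m - 1"]) auto
  \<comment> \<open>Applied with \<open>y = a ^ k\<close>, where
    \<open>degree h = 2 * k\<close>.\<close>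
  have cancel: "coeff h 0 = - y" if "- a * coeff h 0 = a * y" for y
    using that assms(1) by (metis mult_cancel_left mult_minus_left mult_minus_right minus_equation_iff)
  show "nontrivial_self_reciprocal a h" if "trivial_self_reciprocal a ([:- a, 0, 1:] * h)"
    using that half assms
    unfolding trivial_self_reciprocal_def nontrivial_self_reciprocal_def deg coeff by fastforce
  show "trivial_self_reciprocal a h" if "nontrivial_self_reciprocal a ([:- a, 0, 1:] * h)"
    using that half assms cancel
    unfolding trivial_self_reciprocal_def nontrivial_self_reciprocal_def deg coeff
    by (metis power_Suc)
qed

text \<open>Strong induction on the degree, which drops by 2 with each division. Each division also
  swaps the type and the process ends at a nontrivial quotient, so the parity of \<open>k\<close>
  records the type of \<open>f\<close>.\<close>

lemma self_reciprocal_factorization: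
  fixes a :: "'a :: field"
  assumes "(2 :: 'a) \<noteq> 0" "a \<noteq> 0" "a_self_reciprocal_monic a f" "even (degree f)"
  shows "\<exists>k g. f = [:- a, 0, 1:] ^ k * g \<and> nontrivial_self_reciprocal a g \<and>
           \<not> [:- a, 0, 1:] dvd g \<and>
           (trivial_self_reciprocal a f \<longrightarrow> odd k) \<and> (nontrivial_self_reciprocal a f \<longrightarrow> even k)"
  using assms(3,4)
proof (induction "degree f" arbitrary: f rule: less_induct)
  case less
  show ?case
  proof (cases "[:- a, 0, 1:] dvd f")
    case False
    \<comment> \<open>A trivial \<open>f\<close> would be divisible, so \<open>f\<close> is
      nontrivial and serves as \<open>g\<close> itself with \<open>k = 0\<close>.\<close>
    then have "\<not> trivial_self_reciprocal a f"
      using quadratic_dvd_if_trivial assms by blast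
    with False show ?thesis
      using self_reciprocal_cases[OF less.prems(1) assms(2) less.prems(2)]
      by (intro exI[of _ 0] exI[of _ f]) simp
  next
    case True
    then obtain h where f: "f = [:- a, 0, 1:] * h"
      by blast
    have h: "a_self_reciprocal_monic a h"
      using a_self_reciprocal_monic_cancel[OF assms(2)] less.prems(1) f
        a_self_reciprocal_monic_quadratic[OF assms(2)] by blast
    then have "h \<noteq> 0"
      by (auto simp: a_self_reciprocal_monic_def)
    then have "degree f = degree h + 2"
      unfolding f by (subst degree_mult_eq) auto
    with less h obtain k g where kg: "h = [:- a, 0, 1:] ^ k * g" "nontrivial_self_reciprocal a g"
      "\<not> [:- a, 0, 1:] dvd g" "trivial_self_reciprocal a h \<longrightarrow> odd k"
      "nontrivial_self_reciprocal a h \<longrightarrow> even k"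
      by (metis even_add even_numeral less_add_same_cancel1 zero_less_numeral)
    have "f = [:- a, 0, 1:] ^ Suc k * g"
      unfolding f kg(1) power_Suc mult.assoc ..
    moreover have "(trivial_self_reciprocal a f \<longrightarrow> odd (Suc k)) \<and>
        (nontrivial_self_reciprocal a f \<longrightarrow> even (Suc k))"
      using kg(4,5) type_quadratic_mult[OF assms(2) h, folded f] by auto
    ultimately show ?thesis
      using kg(2,3) by blast
  qed
qed

theorem theorem3:
  fixes a :: "'a::{field, finite}"
    and f :: "'a poly"
    and p e :: nat
  assumes "prime p" and "odd p" and "e \<ge> 1" and "CARD('a) = p ^ e"
    and "a \<noteq> 0"
    and "a_self_reciprocal_monic a f"
    and "even (degree f)"
  shows "\<exists>(k::nat) (g :: 'a poly).
           f = [:- a, 0, 1:] ^ k * g \<and>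
           nontrivial_self_reciprocal a g \<and>
           \<not> [:- a, 0, 1:] dvd g \<and>
           (trivial_self_reciprocal a f \<longrightarrow> odd k) \<and>
           (nontrivial_self_reciprocal a f \<longrightarrow> even k)"
proof -
  \<comment> \<open>Oddness of q enters through \<open>2 \<noteq> 0\<close>, which makes
    \<open>2 * a ^ m\<close> invertible.\<close>
  have "odd CARD('a)"
    using assms by simp
  then show ?thesis
    using self_reciprocal_factorization two_neq_0_odd_card assms by blast
qed

end
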